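(* Let $\mu_1,\mu_2,\mu_3,\mu_4$ be four mass distributions in $\mathbb{R}^2$. Then there exist two lines $\ell_1,\ell_2$ (where a line at infinity is allowed) such that $\{\ell_1,\ell_2\}$ simultaneously bisects $\mu_1,\mu_2,\mu_3,\mu_4$.
   Context: A mass distribution $\mu$ on $\mathbb{R}^d$ is a measure on $\mathbb{R}^d$ such that all open subsets are measurable, $0<\mu(\mathbb{R}^d)<\infty$, and $\mu(S)=0$ for every lower-dimensional subset $S$ of $\mathbb{R}^d$. For a finite set $\mathcal{L}$ of oriented hyperplanes (lines when $d=2$), each $\ell\in\mathcal{L}$ has a positive side $\ell^+=\{x: g_\ell(x)\ge 0\}$ and negative side $\ell^-$, where $g_\ell(x)=a_1x_1+\dots+a_dx_d+a_0$ is a defining affine function; hyperplanes at infinity (where $g_\ell\equiv a_0$ is a nonzero constant) are allowed, for which $\ell^+=\mathbb{R}^d$ and $\ell^-=\emptyset$. For $p\in\mathbb{R}^d$ let $\lambda(p)=|\{\ell\in\mathcal{L}: p\in\ell^+\}|$, $R^+=\{p:\lambda(p)\text{ even}\}$, $R^-=\{p:\lambda(p)\text{ odd}\}$. $\mathcal{L}$ simultaneously bisects $\mu_1,\dots,\mu_k$ if $\mu_i(R^+)=\mu_i(R^-)$ for all $i$. A set of unoriented hyperplanes simultaneously bisects the measures if some orientation of them does (equivalently every orientation does). *)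

theory Defs
  imports "HOL-Analysis.Analysis"
begin

definition mass_distribution :: "(real^2) measure \<Rightarrow> bool" where
  "mass_distribution M \<longleftrightarrow>
     space M = UNIV \<and>
     (\<forall>U. open U \<longrightarrow> U \<in> sets M) \<and>
     0 < emeasure M UNIV \<and> emeasure M UNIV < \<infinity> \<and>
     (\<forall>S. S \<in> sets M \<and> aff_dim S < 2 \<longrightarrow> emeasure M S = 0)"

text \<open>An oriented line (possibly at infinity) is given by the coefficients (a, a0) of
  its defining affine function g(x) = a \<bullet> x + a0, with (a, a0) \<noteq> (0, 0).
  If a = 0 this is a line at infinity.\<close>
type_synonym oline = "(real^2) \<times> real"

definition valid_oline :: "oline \<Rightarrow> bool" where
  "valid_oline l \<longleftrightarrow> l \<noteq> (0, 0)"

definition pos_side :: "oline \<Rightarrow> (real^2) set" where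
  "pos_side l = {x. fst l \<bullet> x + snd l \<ge> 0}"

definition lam :: "oline list \<Rightarrow> real^2 \<Rightarrow> nat" where
  "lam L p = length (filter (\<lambda>l. p \<in> pos_side l) L)"

definition R_plus :: "oline list \<Rightarrow> (real^2) set" where
  "R_plus L = {p. even (lam L p)}"

definition R_minus :: "oline list \<Rightarrow> (real^2) set" where
  "R_minus L = {p. odd (lam L p)}"

definition sim_bisects :: "oline list \<Rightarrow> (real^2) measure list \<Rightarrow> bool" where
  "sim_bisects L Ms \<longleftrightarrow>
     (\<forall>M\<in>set Ms. emeasure M (R_plus L) = emeasure M (R_minus L))"

end

theory Submission
  imports Defs "HOL-Homology.Homology"
begin

text \<open>A pair of lines is a degenerate conic, i.e.\ a quadratic form in three variables with
  vanishing determinant. On the unit sphere of the six-dimensional space of such forms the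
  determinant and the four differences (mass where the form is positive minus mass where it is
  negative) are odd functions, so by the Borsuk--Ulam theorem they have a common zero. A form with
  zero determinant is either a product of two linear forms, or semidefinite and nonzero off a line;
  in the second case the differences do not vanish.

  For the Borsuk--Ulam theorem, suppose that the odd functions \<open>f\<^sub>0, \<dots>, f\<^sub>n\<^sub>-\<^sub>1\<close> on the
  \<open>n\<close>-sphere have no common zero, and let \<open>w\<^sub>i\<close> be the 0-cochain modulo 2 that records the sign of
  \<open>f\<^sub>i\<close>. Since the sphere is acyclic below dimension \<open>n\<close>, there are chains \<open>c\<^sub>0\<close> (a point),
  \<open>c\<^sub>1, \<dots>, c\<^sub>n\<close> such that the boundary of \<open>c\<^sub>k\<^sub>+\<^sub>1\<close> is \<open>c\<^sub>k\<close> plus or minus its antipode. The cup product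
  of the coboundaries of \<open>w\<^sub>k\<^sub>-\<^sub>1, \<dots>, w\<^sub>0\<close> takes the same value modulo 2 on \<open>c\<^sub>k\<close> for all \<open>k\<close>,
  namely 1. But after subdivision every simplex of \<open>c\<^sub>n\<close> lies in a set on which some \<open>f\<^sub>i\<close> has
  constant sign, so the value on \<open>c\<^sub>n\<close> is 0.\<close>

section \<open>The Borsuk--Ulam theorem\<close>


text \<open>The Kronecker pairing. The target of \<open>frag_extend\<close> is a free abelian group,
  so the integers appear as the free group on \<open>()\<close>.\<close>

definition chain_eval :: "(((nat \<Rightarrow> real) \<Rightarrow> 'a) \<Rightarrow> int) \<Rightarrow> 'a chain \<Rightarrow> int" where
  "chain_eval \<Phi> c = Poly_Mapping.lookup (frag_extend (\<lambda>\<sigma>. frag_cmul (\<Phi> \<sigma>) (frag_of ())) c) ()"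

lemma chain_eval_0 [simp]: "chain_eval \<Phi> 0 = 0"
  by (simp add: chain_eval_def)

lemma chain_eval_of [simp]: "chain_eval \<Phi> (frag_of \<sigma>) = \<Phi> \<sigma>"
  by (simp add: chain_eval_def)

lemma chain_eval_add: "chain_eval \<Phi> (a + b) = chain_eval \<Phi> a + chain_eval \<Phi> b"
  by (simp add: chain_eval_def frag_extend_add lookup_add)

lemma chain_eval_diff: "chain_eval \<Phi> (a - b) = chain_eval \<Phi> a - chain_eval \<Phi> b"
  by (simp add: chain_eval_def frag_extend_diff lookup_minus)

lemma chain_eval_cmul: "chain_eval \<Phi> (frag_cmul k c) = k * chain_eval \<Phi> c"
  by (simp add: chain_eval_def frag_extend_cmul)

lemma chain_eval_sum: "chain_eval \<Phi> (sum g I) = (\<Sum>i\<in>I. chain_eval \<Phi> (g i))"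
  by (induction I rule: infinite_finite_induct) (simp_all add: chain_eval_add)

lemma chain_eval_chain_map:
  "chain_eval \<Phi> (chain_map p g c) = chain_eval (\<lambda>\<sigma>. \<Phi> (simplex_map p g \<sigma>)) c"
  using subset_UNIV
  by (induction c rule: frag_induction) (auto simp: chain_map_diff chain_eval_diff)

lemma chain_eval_boundary:
  "chain_eval \<Phi> (chain_boundary (Suc p) c)
     = chain_eval (\<lambda>\<sigma>. \<Sum>k\<le>Suc p. (-1) ^ k * \<Phi> (singular_face (Suc p) k \<sigma>)) c"
  using subset_UNIV
proof (induction c rule: frag_induction)
  case (one x)
  then show ?case
    by (simp add: chain_boundary_of chain_eval_add chain_eval_sum chain_eval_cmul del: sum.atMost_Suc)
qed (auto simp: chain_boundary_diff chain_eval_diff)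

lemma chain_eval_add_cochain:
  "chain_eval (\<lambda>\<sigma>. \<Phi> \<sigma> + \<Psi> \<sigma>) c = chain_eval \<Phi> c + chain_eval \<Psi> c"
  using subset_UNIV
  by (induction c rule: frag_induction) (auto simp: chain_eval_diff)

lemma even_chain_eval:
  assumes "\<And>\<sigma>. \<sigma> \<in> Poly_Mapping.keys c \<Longrightarrow> even (\<Phi> \<sigma>)"
  shows "even (chain_eval \<Phi> c)"
  using subset_refl[of "Poly_Mapping.keys c"]
  by (induction c rule: frag_induction) (auto simp: chain_eval_diff assms)

text \<open>The sum of the two cochains is even on every simplex of \<open>c\<close>. Modulo 2
  computations are thus done with integer cochains and parity.\<close>

lemma even_chain_eval_cong:
  assumes "\<And>\<sigma>. \<sigma> \<in> Poly_Mapping.keys c \<Longrightarrow> even (\<Phi> \<sigma>) \<longleftrightarrow> even (\<Psi> \<sigma>)"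
  shows "even (chain_eval \<Phi> c) \<longleftrightarrow> even (chain_eval \<Psi> c)"
proof -
  have "even (chain_eval (\<lambda>\<sigma>. \<Phi> \<sigma> + \<Psi> \<sigma>) c)"
    using assms by (intro even_chain_eval) auto
  then show ?thesis by (simp add: chain_eval_add_cochain)
qed

section \<open>Cup products of coboundaries modulo 2\<close>

definition drop_vertex :: "nat \<Rightarrow> (nat \<Rightarrow> 'a) \<Rightarrow> nat \<Rightarrow> 'a" where
  "drop_vertex j v = (\<lambda>i. if i < j then v i else v (Suc i))"

lemma drop_vertex_0: "drop_vertex 0 v = (\<lambda>i. v (Suc i))"
  by (simp add: drop_vertex_def)

lemma drop_vertex_Suc_0: "drop_vertex (Suc j) v 0 = v 0"
  by (simp add: drop_vertex_def)

lemma drop_vertex_Suc_shift: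
  "(\<lambda>i. drop_vertex (Suc j) v (Suc i)) = drop_vertex j (\<lambda>i. v (Suc i))"
  by (simp add: drop_vertex_def fun_eq_iff)

text \<open>Read modulo 2, \<open>cup_coboundaries w k\<close> is the cup product of the 1-coboundaries
  of \<open>w (k - 1), \<dots>, w 0\<close>, evaluated on a simplex with vertices \<open>v 0, \<dots>, v k\<close>.\<close>

primrec cup_coboundaries :: "(nat \<Rightarrow> 'a \<Rightarrow> int) \<Rightarrow> nat \<Rightarrow> (nat \<Rightarrow> 'a) \<Rightarrow> int" where
  "cup_coboundaries w 0 v = 1"
| "cup_coboundaries w (Suc k) v = (w k (v 0) + w k (v 1)) * cup_coboundaries w k (\<lambda>i. v (Suc i))"

lemma cup_coboundaries_cong:
  assumes "\<And>i. i \<le> k \<Longrightarrow> u i = v i"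
  shows "cup_coboundaries w k u = cup_coboundaries w k v"
  using assms
proof (induction k arbitrary: u v)
  case (Suc k)
  show ?case using Suc.IH[of "\<lambda>i. u (Suc i)" "\<lambda>i. v (Suc i)"] Suc.prems by simp
qed simp

text \<open>Faces 0 and 1 share the remaining factors, and modulo 2 their first factors add up to
  \<open>w k (v 0) + w k (v 1)\<close>, the first factor on every other face. It splits off and
  leaves the sum for \<open>k\<close>.\<close>

lemma cup_coboundaries_cocycle:
  "even (\<Sum>j\<le>Suc k. cup_coboundaries w k (drop_vertex j v))"
proof (induction k arbitrary: v)
  case (Suc k)
  let ?v' = "\<lambda>i. v (Suc i)"
  let ?C = "cup_coboundaries w k"
  have "(\<Sum>j\<le>Suc (Suc k). cup_coboundaries w (Suc k) (drop_vertex j v))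
      = cup_coboundaries w (Suc k) (drop_vertex 0 v)
        + (\<Sum>j\<le>Suc k. cup_coboundaries w (Suc k) (drop_vertex (Suc j) v))"
    by (rule sum.atMost_Suc_shift)
  also have "(\<Sum>j\<le>Suc k. cup_coboundaries w (Suc k) (drop_vertex (Suc j) v))
      = (\<Sum>j\<le>Suc k. (w k (v 0) + w k (drop_vertex j ?v' 0)) * ?C (drop_vertex j ?v'))"
    by (simp only: cup_coboundaries.simps drop_vertex_Suc_shift drop_vertex_Suc_0)
       (simp add: drop_vertex_def)
  also have "\<dots> = (w k (v 0) + w k (v 2)) * ?C (drop_vertex 0 ?v')
      + (\<Sum>j\<le>k. (w k (v 0) + w k (v 1)) * ?C (drop_vertex (Suc j) ?v'))"
    by (simp only: sum.atMost_Suc_shift) (simp add: drop_vertex_def numeral_2_eq_2)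
  also have "cup_coboundaries w (Suc k) (drop_vertex 0 v) = (w k (v 1) + w k (v 2)) * ?C (drop_vertex 0 ?v')"
    by (simp add: drop_vertex_def numeral_2_eq_2)
  finally have eq: "(\<Sum>j\<le>Suc (Suc k). cup_coboundaries w (Suc k) (drop_vertex j v))
     = 2 * w k (v 2) * ?C (drop_vertex 0 ?v') + (w k (v 0) + w k (v 1)) * (\<Sum>j\<le>Suc k. ?C (drop_vertex j ?v'))"
    by (simp only: sum.atMost_Suc_shift sum_distrib_left distrib_left) (simp add: algebra_simps)
  show ?case using Suc.IH[of ?v'] unfolding eq by simp
qed simp

text \<open>Leibniz rule modulo 2: the left side is the coboundary of \<open>w k\<close> times a
  cocycle, so only the term with the coboundary of \<open>w k\<close> survives.\<close>

lemma cup_coboundaries_coboundary: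
  "even (\<Sum>j\<le>Suc k. w k (drop_vertex j v 0) * cup_coboundaries w k (drop_vertex j v))
     \<longleftrightarrow> even (cup_coboundaries w (Suc k) v)"
proof -
  let ?C = "cup_coboundaries w k"
  have "(\<Sum>j\<le>Suc k. w k (drop_vertex j v 0) * ?C (drop_vertex j v))
     = w k (v 1) * ?C (drop_vertex 0 v) + (\<Sum>j\<le>k. w k (v 0) * ?C (drop_vertex (Suc j) v))"
    by (simp only: sum.atMost_Suc_shift) (simp add: drop_vertex_def)
  also have "\<dots> = cup_coboundaries w (Suc k) v + w k (v 0) * (\<Sum>j\<le>Suc k. ?C (drop_vertex j v))
      - 2 * w k (v 0) * ?C (drop_vertex 0 v)"
    by (simp only: sum.atMost_Suc_shift sum_distrib_left) (simp add: algebra_simps drop_vertex_0 flip: sum_distrib_left)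
  finally show ?thesis using cup_coboundaries_cocycle[of w k v] by simp
qed

text \<open>The factor coming from \<open>w i\<close> is \<open>2 * a\<close>.\<close>

lemma even_cup_coboundaries:
  assumes "i < k" "\<And>j. j \<le> k \<Longrightarrow> w i (v j) = a"
  shows "even (cup_coboundaries w k v)"
  using assms
proof (induction k arbitrary: v)
  case (Suc k)
  then show ?case
    by (cases "i = k") auto
qed simp

text \<open>Each factor \<open>s\<close> turns into \<open>2 - s\<close>.\<close>

lemma even_cup_coboundaries_antipodal:
  assumes "\<And>i j. i < k \<Longrightarrow> j \<le> k \<Longrightarrow> w i (u j) = 1 - w i (v j)"
  shows "even (cup_coboundaries w k u) \<longleftrightarrow> even (cup_coboundaries w k v)"
  using assms
proof (induction k arbitrary: u v)
  case (Suc k)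
  show ?case
    using Suc.IH[of "\<lambda>i. u (Suc i)" "\<lambda>i. v (Suc i)"] Suc.prems by auto
qed simp

section \<open>Cup products on antipodal chains\<close>

definition simplex_vertex :: "((nat \<Rightarrow> real) \<Rightarrow> 'a) \<Rightarrow> nat \<Rightarrow> 'a" where
  "simplex_vertex \<sigma> i = \<sigma> (\<lambda>j. if j = i then 1 else 0)"

lemma simplex_vertex_in_topspace:
  assumes "singular_simplex p X \<sigma>" "i \<le> p"
  shows "simplex_vertex \<sigma> i \<in> topspace X"
  using assms basis_in_standard_simplex[of p i] unfolding singular_simplex_def simplex_vertex_def continuous_map_def
  by (auto simp: Pi_iff)

lemma simplex_vertex_singular_face:
  assumes "i \<le> p"
  shows "simplex_vertex (singular_face (Suc p) k \<sigma>) i = drop_vertex k (simplex_vertex \<sigma>) i"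
proof -
  have "simplical_face k (\<lambda>j. if j = i then 1 else 0::real)
      = (\<lambda>j. if j = (if i < k then i else Suc i) then 1 else 0)"
    by (auto simp: simplical_face_def fun_eq_iff)
  with assms show ?thesis
    by (simp add: simplex_vertex_def drop_vertex_def singular_face_def)
qed

lemma simplex_vertex_simplex_map:
  "i \<le> p \<Longrightarrow> simplex_vertex (simplex_map p g \<sigma>) i = g (simplex_vertex \<sigma> i)"
  by (simp add: simplex_vertex_def simplex_map_def)

text \<open>The chains \<open>c k\<close> play the role of the closed upper hemispheres in the cell structure on a
  sphere with two antipodal cells in each dimension.\<close>

definition antipodal_chains :: "nat \<Rightarrow> 'a topology \<Rightarrow> ('a \<Rightarrow> 'a) \<Rightarrow> (nat \<Rightarrow> 'a chain) \<Rightarrow> bool" where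
  "antipodal_chains n X T c \<longleftrightarrow>
     (\<forall>k\<le>n. singular_chain k X (c k)) \<and>
     (\<forall>k<n. chain_boundary (Suc k) (c (Suc k)) = c k + frag_cmul ((-1) ^ Suc k) (chain_map k T (c k)))"

text \<open>By the Leibniz rule the value on \<open>c (Suc k)\<close> is that of \<open>w k\<close>
  times the product for \<open>k\<close> on the boundary, that is, on \<open>c k\<close> and its
  antipode. The two values of \<open>w k\<close> add up to 1, so the value on \<open>c k\<close>
  remains.\<close>

lemma odd_eval_antipodal_chains:
  assumes c: "antipodal_chains n X T c" and c0: "c 0 = frag_of \<sigma>0"
    and w: "\<And>i x. i < n \<Longrightarrow> x \<in> topspace X \<Longrightarrow> w i (T x) = 1 - w i x"
    and "k \<le> n"
  shows "odd (chain_eval (\<lambda>\<sigma>. cup_coboundaries w k (simplex_vertex \<sigma>)) (c k))"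
  using \<open>k \<le> n\<close>
proof (induction k)
  case 0
  then show ?case by (simp add: c0)
next
  case (Suc k)
  let ?C = "\<lambda>k \<sigma>. cup_coboundaries w k (simplex_vertex \<sigma>)"
  let ?F = "\<lambda>\<sigma>. w k (simplex_vertex \<sigma> 0) * ?C k \<sigma>"
  have sing: "singular_chain k X (c k)" "singular_chain (Suc k) X (c (Suc k))"
    and bd: "chain_boundary (Suc k) (c (Suc k)) = c k + frag_cmul ((-1) ^ Suc k) (chain_map k T (c k))"
    using c Suc.prems unfolding antipodal_chains_def by auto
  have "even (chain_eval ?F (chain_boundary (Suc k) (c (Suc k))))
      \<longleftrightarrow> even (chain_eval (?C (Suc k)) (c (Suc k)))"
    unfolding chain_eval_boundary
  proof (rule even_chain_eval_cong)
    fix \<sigma>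
    have "?F (singular_face (Suc k) j \<sigma>) =
        w k (drop_vertex j (simplex_vertex \<sigma>) 0) * cup_coboundaries w k (drop_vertex j (simplex_vertex \<sigma>))" for j
      using cup_coboundaries_cong[of k "simplex_vertex (singular_face (Suc k) j \<sigma>)" "drop_vertex j (simplex_vertex \<sigma>)" w]
      by (simp add: simplex_vertex_singular_face)
    then show "even (\<Sum>j\<le>Suc k. (-1) ^ j * ?F (singular_face (Suc k) j \<sigma>)) \<longleftrightarrow> even (?C (Suc k) \<sigma>)"
      unfolding cup_coboundaries_coboundary[symmetric]
      by (simp only:) (simp add: even_sum_iff)
  qed
  moreover have "even (chain_eval ?F (c k + frag_cmul ((-1) ^ Suc k) (chain_map k T (c k))))
      \<longleftrightarrow> even (chain_eval (\<lambda>\<sigma>. ?F \<sigma> + ?F (simplex_map k T \<sigma>)) (c k))"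
    by (simp add: chain_eval_add chain_eval_cmul chain_eval_chain_map chain_eval_add_cochain)
  moreover have "\<dots> \<longleftrightarrow> even (chain_eval (?C k) (c k))"
  proof (rule even_chain_eval_cong)
    fix \<sigma> assume "\<sigma> \<in> Poly_Mapping.keys (c k)"
    then have \<sigma>: "singular_simplex k X \<sigma>" using sing unfolding singular_chain_def by auto
    have *: "w i (simplex_vertex (simplex_map k T \<sigma>) j) = 1 - w i (simplex_vertex \<sigma> j)"
      if "i < n" "j \<le> k" for i j
      using that \<sigma> by (simp add: simplex_vertex_simplex_map w simplex_vertex_in_topspace)
    have "even (?C k (simplex_map k T \<sigma>)) \<longleftrightarrow> even (?C k \<sigma>)"
      using * Suc.prems by (intro even_cup_coboundaries_antipodal) auto
    then show "even (?F \<sigma> + ?F (simplex_map k T \<sigma>)) \<longleftrightarrow> even (?C k \<sigma>)"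
      using *[of k 0] Suc.prems by auto
  qed
  ultimately show ?case using Suc.IH Suc.prems bd by simp
qed


section \<open>Subdivision and construction of antipodal chains\<close>

lemma iterated_subdivision_chain:
  assumes "singular_chain p X c"
  shows "singular_chain p X ((singular_subdivision p ^^ m) c)"
  by (induction m) (auto simp: assms singular_chain_singular_subdivision)

lemma iterated_subdivision_boundary:
  assumes "singular_chain p X c"
  shows "chain_boundary p ((singular_subdivision p ^^ m) c)
       = (singular_subdivision (p - Suc 0) ^^ m) (chain_boundary p c)"
  by (induction m)
     (auto simp: chain_boundary_singular_subdivision[OF iterated_subdivision_chain[OF assms]])

lemma iterated_subdivision_chain_map:
  assumes "singular_chain p X c"
  shows "(singular_subdivision p ^^ m) (chain_map p g c) = chain_map p g ((singular_subdivision p ^^ m) c)"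
  by (induction m)
     (auto simp: naturality_singular_subdivision[OF iterated_subdivision_chain[OF assms]])

lemma iterated_subdivision_add_cmul:
  "(singular_subdivision p ^^ m) (a + frag_cmul s b)
     = (singular_subdivision p ^^ m) a + frag_cmul s ((singular_subdivision p ^^ m) b)"
  by (induction m) (auto simp: singular_subdivision_def frag_extend_add frag_extend_cmul)

text \<open>Subdivision commutes with boundaries and with chain maps; using the same
  \<open>m\<close> in every dimension preserves the relations between consecutive chains.\<close>

lemma antipodal_chains_subdivision:
  assumes "antipodal_chains n X T c"
  shows "antipodal_chains n X T (\<lambda>k. (singular_subdivision k ^^ m) (c k))"
  using assms unfolding antipodal_chains_def
  by (auto simp: iterated_subdivision_chain iterated_subdivision_boundary[where X=X]
      iterated_subdivision_add_cmul iterated_subdivision_chain_map[where X=X] simp del: power_Suc)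

lemma frag_cmul_neg_one_power_cancel:
  "frag_cmul ((-1) ^ k) c + frag_cmul ((-1) ^ Suc k) c = 0"
  by (simp flip: frag_cmul_distrib)

text \<open>The prescribed boundary \<open>z\<close> is a cycle: applying \<open>T\<close>
  multiplies the boundary of \<open>c m\<close> by \<open>(-1) ^ m\<close>, and the coefficient
  \<open>(-1) ^ Suc m\<close> in \<open>z\<close> makes the sum vanish. As homology in degree
  \<open>m\<close> is trivial, \<open>z\<close> bounds.\<close>

lemma antipodal_chains_extend:
  assumes c: "antipodal_chains m X T c" and T: "continuous_map X X T"
    and TT: "\<And>x. x \<in> topspace X \<Longrightarrow> T (T x) = x" and "m > 0"
    and triv: "trivial_group (homology_group (int m) X)"
  shows "\<exists>d. antipodal_chains (Suc m) X T (c(Suc m := d))"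
proof -
  define z where "z = c m + frag_cmul ((-1) ^ Suc m) (chain_map m T (c m))"
  obtain j where m: "m = Suc j" using \<open>m > 0\<close> by (cases m) auto
  have sc: "singular_chain m X (c m)" and scj: "singular_chain j X (c j)"
    and bd: "chain_boundary m (c m) = c j + frag_cmul ((-1) ^ m) (chain_map j T (c j))"
    using c by (auto simp: antipodal_chains_def m)
  have TTc: "chain_map j T (chain_map j T (c j)) = c j"
    using chain_map_id_gen[OF scj, of "T \<circ> T"] TT by (simp add: chain_map_compose)
  have z: "singular_chain m X z"
    unfolding z_def by (intro singular_chain_add singular_chain_cmul singular_chain_chain_map[OF sc T] sc)
  have "chain_boundary m z = (c j + frag_cmul ((-1) ^ m) (chain_map j T (c j)))
          + frag_cmul ((-1) ^ Suc m) (chain_map j T (c j) + frag_cmul ((-1) ^ m) (c j))"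
    using chain_boundary_chain_map[OF sc, of T]
    by (simp add: z_def chain_boundary_add chain_boundary_cmul bd[unfolded m] m chain_map_add TTc del: power_Suc)
  also have "\<dots> = (frag_cmul ((-1) ^ m) (chain_map j T (c j)) + frag_cmul ((-1) ^ Suc m) (chain_map j T (c j)))
          + (c j + frag_cmul ((-1) ^ Suc m * (-1) ^ m) (c j))"
    by (simp only: frag_cmul_distrib2 frag_cmul_cmul add_ac)
  also have "\<dots> = 0"
    unfolding frag_cmul_neg_one_power_cancel by simp
  finally have "singular_relcycle m X {} z"
    using z by (simp add: singular_cycle)
  then have "homologous_rel_set m X {} z \<in> carrier (homology_group (int m) X)"
    by (auto simp: carrier_relative_homology_group)
  then have "homologous_rel_set m X {} z = singular_relboundary_set m X {}"
    using triv by (auto simp: trivial_group_def)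
  then have "singular_relboundary m X {} z"
    by (simp add: homologous_rel_set_eq_relboundary)
  then obtain d where d: "singular_chain (Suc m) X d" "chain_boundary (Suc m) d = z"
    by (auto simp: singular_boundary)
  have "antipodal_chains (Suc m) X T (c(Suc m := d))"
    using c d by (auto simp: antipodal_chains_def z_def less_Suc_eq le_Suc_eq simp del: power_Suc)
  then show ?thesis by blast
qed

text \<open>Reduced homology is the kernel of the map induced by the projection to a point. Two
  0-simplices have the same image there, so their difference represents a class in this
  kernel.\<close>

lemma singular_boundary_diff_of_trivial_reduced_homology:
  assumes triv: "trivial_group (reduced_homology_group 0 X)"
    and s: "singular_simplex 0 X s" and t: "singular_simplex 0 X t"
  shows "singular_relboundary 0 X {} (frag_of s - frag_of t)"
proof -
  let ?z = "frag_of s - frag_of t" and ?P = "discrete_topology {()}" and ?u = "\<lambda>x. ()"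
  have cyc: "singular_relcycle 0 X {} ?z"
    using s t by (simp add: singular_cycle singular_chain_diff singular_chain_of chain_boundary_def)
  have "simplex_map 0 ?u s = simplex_map 0 ?u t"
    by (simp add: simplex_map_def comp_def)
  then have "chain_map 0 ?u ?z = 0"
    by (simp add: chain_map_diff)
  then have "hom_induced (int 0) X {} ?P {} ?u (homologous_rel_set 0 X {} ?z)
      = \<one>\<^bsub>homology_group (int 0) ?P\<^esub>"
    using hom_induced_chain_map[of X ?P ?u "{}" "{}" 0 ?z] cyc
    by (simp add: homologous_rel_set_eq_relboundary del: of_nat_0)
  then have "homologous_rel_set 0 X {} ?z \<in> carrier (reduced_homology_group (int 0) X)"
    unfolding carrier_reduced_homology_group kernel_def carrier_relative_homology_group
    using cyc by auto
  then have "homologous_rel_set 0 X {} ?z = \<one>\<^bsub>homology_group (int 0) X\<^esub>"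
    using triv by (auto simp: trivial_group_def one_reduced_homology_group)
  then show ?thesis
    unfolding one_relative_homology_group homologous_rel_set_eq_relboundary .
qed

text \<open>The chains are built upwards from a point by filling cycles. The first step is separate
  because a difference of points is controlled by reduced homology only; in positive degrees this
  agrees with ordinary homology.\<close>

lemma antipodal_chains_exist:
  assumes T: "continuous_map X X T" and TT: "\<And>x. x \<in> topspace X \<Longrightarrow> T (T x) = x"
    and triv: "\<And>p. p < n \<Longrightarrow> trivial_group (reduced_homology_group (int p) X)"
    and a: "a \<in> topspace X"
  shows "\<exists>c \<sigma>. antipodal_chains n X T c \<and> c 0 = frag_of \<sigma>"
proof -
  have "singular_simplex 0 X (restrict (\<lambda>x. a) (standard_simplex 0))"
    using a by (auto simp: singular_simplex_def continuous_map_in_subtopology)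
  then obtain s where s: "singular_simplex 0 X s" by blast
  have "\<exists>c. antipodal_chains m X T c \<and> c 0 = frag_of s" if "m \<le> n" for m
    using that
  proof (induction m)
    case 0
    show ?case
      by (rule exI[of _ "\<lambda>_. frag_of s"]) (use s in \<open>simp add: antipodal_chains_def singular_chain_of\<close>)
  next
    case (Suc m)
    then obtain c where c: "antipodal_chains m X T c" "c 0 = frag_of s" by auto
    show ?case
    proof (cases "m = 0")
      case True
      have "singular_relboundary 0 X {} (frag_of s - frag_of (simplex_map 0 T s))"
        using singular_boundary_diff_of_trivial_reduced_homology[OF _ s singular_simplex_simplex_map[OF s T]]
          triv[of 0] Suc.prems by simp
      then obtain d where d: "singular_chain (Suc 0) X d"
        "chain_boundary (Suc 0) d = frag_of s - frag_of (simplex_map 0 T s)"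
        by (auto simp: singular_boundary)
      have "antipodal_chains (Suc m) X T (c(Suc m := d))"
        using c d True by (auto simp: antipodal_chains_def le_Suc_eq)
      moreover have "(c(Suc m := d)) 0 = frag_of s" using c by simp
      ultimately show ?thesis by blast
    next
      case False
      then obtain d where "antipodal_chains (Suc m) X T (c(Suc m := d))"
        using antipodal_chains_extend[OF c(1) T TT] triv[of m] Suc.prems by (auto simp: un_reduced_homology_group)
      moreover have "(c(Suc m := d)) 0 = frag_of s" using c by simp
      ultimately show ?thesis by blast
    qed
  qed
  then show ?thesis by blast
qed

theorem Borsuk_Ulam_nsphere:
  fixes f :: "nat \<Rightarrow> (nat \<Rightarrow> real) \<Rightarrow> real"
  assumes cont: "\<And>i. i < n \<Longrightarrow> continuous_map (nsphere n) euclideanreal (f i)"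
    and odd: "\<And>i x. i < n \<Longrightarrow> x \<in> topspace (nsphere n) \<Longrightarrow> f i (\<lambda>j. - x j) = - f i x"
  shows "\<exists>x \<in> topspace (nsphere n). \<forall>i<n. f i x = 0"
proof (rule ccontr)
  let ?X = "nsphere n"
  let ?T = "\<lambda>x j. - x j :: real"
  assume no0: "\<not> ?thesis"
  have T: "continuous_map ?X ?X ?T"
    unfolding nsphere
    by (auto simp: continuous_map_in_subtopology continuous_map_componentwise_UNIV
        intro!: continuous_intros continuous_map_from_subtopology)
  have triv: "trivial_group (reduced_homology_group (int p) ?X)" if "p < n" for p
    using that trivial_reduced_homology_group_nsphere[of "int p" n] by simp
  obtain c \<sigma> where c: "antipodal_chains n ?X ?T c" and c0: "c 0 = frag_of \<sigma>"
    using antipodal_chains_exist[OF T _ triv in_topspace_nsphere, where n=n] by auto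
  \<comment> \<open>These open sets cover the sphere because the \<open>f i\<close> have no common
    zero.\<close>
  define \<C> where "\<C> = {{x \<in> topspace ?X. s * f i x > 0} |i s. i < n \<and> (s = 1 \<or> s = -1)}"
  have op: "openin ?X U" if "U \<in> \<C>" for U
  proof -
    obtain i s where U: "U = {x \<in> topspace ?X. s * f i x > 0}" "i < n"
      using \<open>U \<in> \<C>\<close> unfolding \<C>_def by blast
    have "continuous_map ?X euclideanreal (\<lambda>x. s * f i x)"
      using cont[OF \<open>i < n\<close>] by (intro continuous_intros)
    from openin_continuous_map_preimage[OF this, of "{0<..}"] show ?thesis
      by (simp add: U)
  qed
  have cov: "topspace ?X \<subseteq> \<Union>\<C>"
  proof
    fix x assume x: "x \<in> topspace ?X"
    with no0 obtain i where i: "i < n" "f i x \<noteq> 0" by blast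
    then have "x \<in> {y \<in> topspace ?X. sgn (f i x) * f i y > 0}"
      using x by (auto simp: sgn_if)
    moreover have "{y \<in> topspace ?X. sgn (f i x) * f i y > 0} \<in> \<C>"
    proof -
      have "sgn (f i x) = 1 \<or> sgn (f i x) = -1" using i by (auto simp: sgn_if)
      then show ?thesis using i unfolding \<C>_def by blast
    qed
    ultimately show "x \<in> \<Union>\<C>" by blast
  qed
  obtain m where m: "\<And>\<tau>. \<tau> \<in> Poly_Mapping.keys ((singular_subdivision n ^^ m) (c n))
        \<Longrightarrow> \<exists>V \<in> \<C>. \<tau> \<in> standard_simplex n \<rightarrow> V"
    using sufficient_iterated_singular_subdivision_exists[OF op cov, of n "c n"] c
    unfolding antipodal_chains_def by (metis order_refl)
  let ?c = "\<lambda>k. (singular_subdivision k ^^ m) (c k)"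
  have "singular_chain 0 ?X (frag_of \<sigma>)"
    using c c0 unfolding antipodal_chains_def by auto
  \<comment> \<open>Subdivision is the identity in degree 0, so the initial point is kept.\<close>
  then have "?c 0 = frag_of \<sigma>"
    by (induction m) (auto simp: c0 singular_subdivision_zero)
  \<comment> \<open>An odd tie-break, so that the sign of \<open>f i\<close> is antipodal also where \<open>f i\<close> vanishes.\<close>
  define lead where "lead x = x (LEAST j. x j \<noteq> (0::real))" for x :: "nat \<Rightarrow> real"
  have lead: "lead x \<noteq> 0" if "x \<in> topspace ?X" for x
  proof -
    have "\<exists>j. x j \<noteq> 0" using that by (auto simp: nsphere intro: ccontr)
    then show ?thesis unfolding lead_def by (rule LeastI_ex)
  qed
  have leadT: "lead (?T x) = - lead x" for x by (simp add: lead_def)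
  define w where "w i x = (if f i x > 0 \<or> (f i x = 0 \<and> lead x > 0) then 1 else 0 :: int)" for i x
  have "w i (?T x) = 1 - w i x" if "i < n" "x \<in> topspace ?X" for i x
    using odd[OF that] lead[OF that(2)] by (auto simp: w_def leadT)
  then have "odd (chain_eval (\<lambda>\<sigma>. cup_coboundaries w n (simplex_vertex \<sigma>)) (?c n))"
    using odd_eval_antipodal_chains[OF antipodal_chains_subdivision[OF c, of m] \<open>?c 0 = _\<close>] by blast
  moreover have "even (chain_eval (\<lambda>\<sigma>. cup_coboundaries w n (simplex_vertex \<sigma>)) (?c n))"
  proof (rule even_chain_eval)
    fix \<tau> assume "\<tau> \<in> Poly_Mapping.keys (?c n)"
    then obtain V where "V \<in> \<C>" and V: "\<tau> \<in> standard_simplex n \<rightarrow> V" using m by blast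
    then obtain i s where U: "V = {x \<in> topspace ?X. s * f i x > 0}" "i < n" and s: "s = 1 \<or> s = -1"
      unfolding \<C>_def by blast
    have "simplex_vertex \<tau> j \<in> V" if "j \<le> n" for j
      using that V basis_in_standard_simplex[of n j] by (auto simp: simplex_vertex_def Pi_iff)
    \<comment> \<open>The inequality defining \<open>V\<close> is strict, so \<open>s\<close> alone
      determines \<open>w i\<close> on the vertices.\<close>
    then have "w i (simplex_vertex \<tau> j) = (if s = 1 then 1 else 0)" if "j \<le> n" for j
      using that U s by (fastforce simp: w_def)
    then show "even (cup_coboundaries w n (simplex_vertex \<tau>))"
      using \<open>i < n\<close> by (intro even_cup_coboundaries) auto
  qed
  ultimately show False by simp
qed

section \<open>Degenerate conics\<close>

text \<open>Complete the square with respect to \<open>A\<close>; if \<open>A = 0\<close>, then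
  \<open>B = 0\<close> and only the term in \<open>C\<close> remains.\<close>

lemma singular_binary_form:
  fixes A B C :: real
  assumes "A * C = B\<^sup>2"
  shows "\<exists>s p q. (s = 1 \<or> s = -1) \<and> (\<forall>x y. A * x\<^sup>2 + 2 * B * x * y + C * y\<^sup>2 = s * (p * x + q * y)\<^sup>2)"
proof -
  consider "A > 0" | "A < 0" | "A = 0" by linarith
  then show ?thesis
  proof cases
    case 1
    have C: "C = B\<^sup>2 / A" using assms 1 by (simp add: field_simps)
    show ?thesis
      by (rule exI[of _ 1], rule exI[of _ "sqrt A"], rule exI[of _ "B / sqrt A"])
         (use 1 in \<open>auto simp: C power2_sum power_mult_distrib power_divide\<close>)
  next
    case 2
    have C: "C = B\<^sup>2 / A" using assms 2 by (simp add: field_simps)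
    show ?thesis
      by (rule exI[of _ "-1"], rule exI[of _ "sqrt (-A)"], rule exI[of _ "- B / sqrt (-A)"])
         (use 2 in \<open>auto simp: C power2_diff power_mult_distrib power_divide\<close>)
  next
    case 3
    then have "B = 0" using assms by simp
    show ?thesis
      by (rule exI[of _ "if C \<ge> 0 then 1 else -1"], rule exI[of _ 0], rule exI[of _ "sqrt \<bar>C\<bar>"])
         (auto simp: 3 \<open>B = 0\<close> power_mult_distrib)
  qed
qed

text \<open>Real line pairs satisfy the first alternative. Complex conjugate pairs satisfy the
  second: up to a factor the form is a sum of two squares, and one square suffices to fix the sign
  off a line. The factor \<open>s\<close> carries sign and scale.\<close>

definition degenerate_conic_form :: "(real \<Rightarrow> real \<Rightarrow> real \<Rightarrow> real) \<Rightarrow> bool" where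
  "degenerate_conic_form Q \<longleftrightarrow>
    (\<exists>p q r p' q' r'. (p, q, r) \<noteq> (0, 0, 0) \<and> (p', q', r') \<noteq> (0, 0, 0) \<and>
       (\<forall>z x y. Q z x y = (p * z + q * x + r * y) * (p' * z + q' * x + r' * y))) \<or>
    (\<exists>p q r s. (p, q, r) \<noteq> (0, 0, 0) \<and> (\<forall>z x y. s * Q z x y \<ge> (p * z + q * x + r * y)\<^sup>2))"

lemma degenerate_conic_form_product:
  assumes "(p, q, r) \<noteq> (0, 0, 0)" "(p', q', r') \<noteq> (0, 0, 0)"
    and "\<And>z x y. Q z x y = (p * z + q * x + r * y) * (p' * z + q' * x + r' * y)"
  shows "degenerate_conic_form Q"
  unfolding degenerate_conic_form_def
  by (rule disjI1, rule exI[of _ p], rule exI[of _ q], rule exI[of _ r],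
      rule exI[of _ p'], rule exI[of _ q'], rule exI[of _ r']) (intro conjI allI assms)

lemma degenerate_conic_form_semidefinite:
  assumes "(p, q, r) \<noteq> (0, 0, 0)"
    and "\<And>z x y. s * Q z x y \<ge> (p * z + q * x + r * y)\<^sup>2"
  shows "degenerate_conic_form Q"
  unfolding degenerate_conic_form_def
  by (rule disjI2, rule exI[of _ p], rule exI[of _ q], rule exI[of _ r], rule exI[of _ s])
     (intro conjI allI assms)

text \<open>A cyclic permutation of the variables; repeated, it moves any diagonal coefficient to
  the leading position.\<close>

lemma degenerate_conic_form_rotate:
  assumes "degenerate_conic_form (\<lambda>z x y. Q x y z)"
  shows "degenerate_conic_form Q"
  using assms[unfolded degenerate_conic_form_def]
proof (elim disjE exE conjE)
  fix p q r p' q' r'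
  assume "(p, q, r) \<noteq> (0, 0, 0)" "(p', q', r') \<noteq> (0, 0, 0)"
    "\<forall>z x y. Q x y z = (p * z + q * x + r * y) * (p' * z + q' * x + r' * y)"
  then show ?thesis
    by (intro degenerate_conic_form_product[of q r p q' r' p']) (auto simp: add_ac)
next
  fix p q r s
  assume "(p, q, r) \<noteq> (0, 0, 0)" "\<forall>z x y. s * Q x y z \<ge> (p * z + q * x + r * y)\<^sup>2"
  then show ?thesis
    by (intro degenerate_conic_form_semidefinite[of q r p s]) (auto simp: add_ac)
qed

text \<open>Completing the square in \<open>z\<close> writes \<open>a\<close> times the form as a
  square minus a binary form whose determinant is \<open>a\<close> times the given one, hence zero.
  That binary form is plus or minus a square. The result is a difference of squares, which factors,
  or a sum of squares.\<close>

lemma degenerate_conic_form_leading: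
  fixes a b c d e f :: real
  assumes det: "a * (d * f - e\<^sup>2) - b * (b * f - c * e) + c * (b * e - c * d) = 0" and "a \<noteq> 0"
  shows "degenerate_conic_form
    (\<lambda>z x y. a * z\<^sup>2 + 2 * b * z * x + 2 * c * z * y + d * x\<^sup>2 + 2 * e * x * y + f * y\<^sup>2)"
    (is "degenerate_conic_form ?Q")
proof -
  have "(b\<^sup>2 - a * d) * (c\<^sup>2 - a * f) - (b * c - a * e)\<^sup>2
      = a * (a * (d * f - e\<^sup>2) - b * (b * f - c * e) + c * (b * e - c * d))"
    by (simp add: algebra_simps power2_eq_square)
  then have "(b\<^sup>2 - a * d) * (c\<^sup>2 - a * f) = (b * c - a * e)\<^sup>2"
    using det by simp
  then obtain s p q where s: "s = 1 \<or> s = -1" and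
    pq: "\<And>x y. (b\<^sup>2 - a * d) * x\<^sup>2 + 2 * (b * c - a * e) * x * y + (c\<^sup>2 - a * f) * y\<^sup>2 = s * (p * x + q * y)\<^sup>2"
    using singular_binary_form by meson
  have sq: "a * ?Q z x y = (a * z + b * x + c * y)\<^sup>2 - s * (p * x + q * y)\<^sup>2" for z x y
    unfolding pq[symmetric] by (simp add: algebra_simps power2_eq_square)
  show ?thesis
  proof (cases "s = 1")
    case True
    \<comment> \<open>The factors of the difference of squares, the first one divided by
      \<open>a\<close>.\<close>
    have eq: "?Q z x y = (1 * z + ((b + p) / a) * x + ((c + q) / a) * y) * (a * z + (b - p) * x + (c - q) * y)"
      for z x y
    proof -
      have "a * ?Q z x y = a * ((1 * z + ((b + p) / a) * x + ((c + q) / a) * y) * (a * z + (b - p) * x + (c - q) * y))"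
        unfolding sq True using \<open>a \<noteq> 0\<close> by (simp add: field_simps power2_eq_square)
      then show ?thesis using \<open>a \<noteq> 0\<close> by (simp only: mult_cancel_left) simp
    qed
    have "(1::real, (b + p) / a, (c + q) / a) \<noteq> (0,0,0)" "(a, b - p, c - q) \<noteq> (0,0,0)"
      using \<open>a \<noteq> 0\<close> by auto
    then show ?thesis using eq by (rule degenerate_conic_form_product)
  next
    case False
    then have "a * ?Q z x y \<ge> (a * z + b * x + c * y)\<^sup>2" for z x y
      using s sq[of z x y] by simp
    moreover have "(a, b, c) \<noteq> (0,0,0)" using \<open>a \<noteq> 0\<close> by auto
    ultimately show ?thesis by (intro degenerate_conic_form_semidefinite)
  qed
qed

lemma degenerate_conic_form_of_det_zero:
  fixes a b c d e f :: real
  assumes det: "a * (d * f - e\<^sup>2) - b * (b * f - c * e) + c * (b * e - c * d) = 0"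
    and nz: "(a, b, c, d, e, f) \<noteq> (0, 0, 0, 0, 0, 0)"
  shows "degenerate_conic_form
    (\<lambda>z x y. a * z\<^sup>2 + 2 * b * z * x + 2 * c * z * y + d * x\<^sup>2 + 2 * e * x * y + f * y\<^sup>2)"
    (is "degenerate_conic_form ?Q")
proof -
  \<comment> \<open>A nonzero diagonal entry is rotated to the front. Without one the determinant is
    \<open>2 * b * c * e\<close>, so an off-diagonal entry vanishes and a variable splits
    off.\<close>
  consider "a \<noteq> 0" | "d \<noteq> 0" | "f \<noteq> 0" | "a = 0" "d = 0" "f = 0" by blast
  then show ?thesis
  proof cases
    case 1
    then show ?thesis using degenerate_conic_form_leading[OF det] by simp
  next
    case 2
    have "d * (f * a - c\<^sup>2) - e * (e * a - b * c) + b * (e * c - b * f) = 0"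
      using det by (simp add: algebra_simps power2_eq_square)
    moreover have "(\<lambda>z x y. d * z\<^sup>2 + 2 * e * z * x + 2 * b * z * y + f * x\<^sup>2 + 2 * c * x * y + a * y\<^sup>2)
        = (\<lambda>z x y. ?Q y z x)"
      by (intro ext) (simp add: algebra_simps)
    ultimately have "degenerate_conic_form (\<lambda>z x y. ?Q y z x)"
      using degenerate_conic_form_leading[of d f a c e b] 2 by simp
    then show ?thesis
      by (intro degenerate_conic_form_rotate[of ?Q] degenerate_conic_form_rotate[of "\<lambda>z x y. ?Q x y z"])
  next
    case 3
    have "f * (a * d - b\<^sup>2) - c * (c * d - e * b) + e * (c * b - e * a) = 0"
      using det by (simp add: algebra_simps power2_eq_square)
    moreover have "(\<lambda>z x y. f * z\<^sup>2 + 2 * c * z * x + 2 * e * z * y + a * x\<^sup>2 + 2 * b * x * y + d * y\<^sup>2)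
        = (\<lambda>z x y. ?Q x y z)"
      by (intro ext) (simp add: algebra_simps)
    ultimately have "degenerate_conic_form (\<lambda>z x y. ?Q x y z)"
      using degenerate_conic_form_leading[of f a d b c e] 3 by simp
    then show ?thesis
      by (rule degenerate_conic_form_rotate[of ?Q])
  next
    case 4
    then have "b * c * e = 0" using det by (simp add: algebra_simps)
    then consider "b = 0" | "c = 0" | "e = 0" by auto
    then show ?thesis
    proof cases
      case 1
      have "(c, e, 0) \<noteq> (0,0,0)" "(0,0,2::real) \<noteq> (0,0,0)" using nz 4 1 by auto
      moreover have "?Q z x y = (c * z + e * x + 0 * y) * (0 * z + 0 * x + 2 * y)" for z x y
        using 4 1 by (simp add: algebra_simps)
      ultimately show ?thesis by (rule degenerate_conic_form_product)
    next
      case 2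
      have "(b, 0, e) \<noteq> (0,0,0)" "(0,2::real,0::real) \<noteq> (0,0,0)" using nz 4 2 by auto
      moreover have "?Q z x y = (b * z + 0 * x + e * y) * (0 * z + 2 * x + 0 * y)" for z x y
        using 4 2 by (simp add: algebra_simps)
      ultimately show ?thesis by (rule degenerate_conic_form_product)
    next
      case 3
      have "(0, b, c) \<noteq> (0,0,0)" "(2::real,0::real,0::real) \<noteq> (0,0,0)" using nz 4 3 by auto
      moreover have "?Q z x y = (0 * z + b * x + c * y) * (2 * z + 0 * x + 0 * y)" for z x y
        using 4 3 by (simp add: algebra_simps)
      ultimately show ?thesis by (rule degenerate_conic_form_product)
    qed
  qed
qed

section \<open>Conics in the affine plane\<close>

text \<open>The coefficients \<open>q 0, \<dots>, q 5\<close> are the entries of the symmetric matrix with rows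
  \<open>(q 0, q 1, q 2)\<close>, \<open>(q 1, q 3, q 4)\<close>, \<open>(q 2, q 4, q 5)\<close>, in the homogeneous coordinates \<open>(1, x$1, x$2)\<close>.\<close>

definition conic_poly :: "(nat \<Rightarrow> real) \<Rightarrow> real^2 \<Rightarrow> real" where
  "conic_poly q x = q 0 + 2 * q 1 * x$1 + 2 * q 2 * x$2 + q 3 * (x$1)\<^sup>2 + 2 * q 4 * x$1 * x$2 + q 5 * (x$2)\<^sup>2"

definition conic_det :: "(nat \<Rightarrow> real) \<Rightarrow> real" where
  "conic_det q = q 0 * (q 3 * q 5 - (q 4)\<^sup>2) - q 1 * (q 1 * q 5 - q 2 * q 4) + q 2 * (q 1 * q 4 - q 2 * q 3)"

definition line_fun :: "oline \<Rightarrow> real^2 \<Rightarrow> real" where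
  "line_fun l x = fst l \<bullet> x + snd l"

text \<open>Coefficients with \<open>q = r = 0\<close> yield a line at infinity. The factor
  \<open>1\<close> keeps the shape of a ternary form at \<open>z = 1\<close>.\<close>

lemma line_fun_coeffs:
  assumes "(p, q, r) \<noteq> (0, 0, 0)"
  obtains l where "valid_oline l" "\<And>x. line_fun l x = p * 1 + q * x$1 + r * x$2"
proof
  show "valid_oline (vector [q, r], p)"
    using assms by (auto simp: valid_oline_def vec_eq_iff forall_2)
  show "line_fun (vector [q, r], p) x = p * 1 + q * x$1 + r * x$2" for x
    by (simp add: line_fun_def inner_vec_def sum_2)
qed

lemma degenerate_conic_cases:
  assumes "conic_det q = 0" "\<exists>i\<le>5. q i \<noteq> 0"
  shows "(\<exists>l1 l2. valid_oline l1 \<and> valid_oline l2 \<and> (\<forall>x. conic_poly q x = line_fun l1 x * line_fun l2 x)) \<or>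
         (\<exists>l s. valid_oline l \<and> (\<forall>x. s * conic_poly q x \<ge> (line_fun l x)\<^sup>2))"
proof -
  let ?Q = "\<lambda>z x y. q 0 * z\<^sup>2 + 2 * q 1 * z * x + 2 * q 2 * z * y + q 3 * x\<^sup>2 + 2 * q 4 * x * y + q 5 * y\<^sup>2"
  have Q: "conic_poly q x = ?Q 1 (x$1) (x$2)" for x by (simp add: conic_poly_def)
  have "(q 0, q 1, q 2, q 3, q 4, q 5) \<noteq> (0,0,0,0,0,0)"
  proof
    assume "(q 0, q 1, q 2, q 3, q 4, q 5) = (0,0,0,0,0,0)"
    moreover have "i = 0 \<or> i = 1 \<or> i = 2 \<or> i = 3 \<or> i = 4 \<or> i = 5" if "i \<le> 5" for i :: nat
      using that by arith
    ultimately show False using assms(2) by fastforce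
  qed
  then have "degenerate_conic_form ?Q"
    using assms(1) unfolding conic_det_def by (intro degenerate_conic_form_of_det_zero)
  then show ?thesis
    unfolding degenerate_conic_form_def
  proof (elim disjE exE conjE)
    fix a b c a' b' c'
    assume nz: "(a, b, c) \<noteq> (0, 0, 0)" "(a', b', c') \<noteq> (0, 0, 0)"
      and eq: "\<forall>z x y. ?Q z x y = (a * z + b * x + c * y) * (a' * z + b' * x + c' * y)"
    obtain l1 where "valid_oline l1" "\<And>x. line_fun l1 x = a * 1 + b * x$1 + c * x$2"
      using line_fun_coeffs[OF nz(1)] by metis
    moreover obtain l2 where "valid_oline l2" "\<And>x. line_fun l2 x = a' * 1 + b' * x$1 + c' * x$2"
      using line_fun_coeffs[OF nz(2)] by metis
    moreover have "conic_poly q x = (a * 1 + b * x$1 + c * x$2) * (a' * 1 + b' * x$1 + c' * x$2)" for x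
      unfolding Q by (rule eq[rule_format])
    ultimately show ?thesis by metis
  next
    fix a b c s
    assume nz: "(a, b, c) \<noteq> (0, 0, 0)"
      and le: "\<forall>z x y. s * ?Q z x y \<ge> (a * z + b * x + c * y)\<^sup>2"
    obtain l where "valid_oline l" "\<And>x. line_fun l x = a * 1 + b * x$1 + c * x$2"
      using line_fun_coeffs[OF nz] by metis
    moreover have "s * conic_poly q x \<ge> (a * 1 + b * x$1 + c * x$2)\<^sup>2" for x
      unfolding Q by (rule le[rule_format])
    ultimately show ?thesis by metis
  qed
qed

section \<open>Bisection by degenerate conics\<close>

lemma mass_distribution_finite: "mass_distribution M \<Longrightarrow> finite_measure M"
  by (intro finite_measureI) (auto simp: mass_distribution_def)

text \<open>The sigma-algebra of \<open>M\<close> may be larger than the Borel one; it contains the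
  open sets and hence all that they generate.\<close>

lemma mass_distribution_borel_sets:
  assumes "mass_distribution M" "A \<in> sets borel"
  shows "A \<in> sets M"
proof -
  have "sigma_sets (space M) {U. open U} \<subseteq> sets M"
    using assms(1) by (intro sets.sigma_sets_subset) (auto simp: mass_distribution_def)
  then show ?thesis
    using assms by (auto simp: borel_def mass_distribution_def)
qed

lemma mass_distribution_borel_measurable:
  assumes "mass_distribution M" "f \<in> borel_measurable borel"
  shows "f \<in> borel_measurable M"
  using assms mass_distribution_borel_sets[OF assms(1)] measurable_sets[OF assms(2)]
  by (intro measurableI) (auto simp: mass_distribution_def)

lemma mass_distribution_line_null:
  assumes M: "mass_distribution M" and l: "valid_oline l"
  shows "AE x in M. line_fun l x \<noteq> 0"
proof -
  let ?S = "{x. line_fun l x = 0}"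
  have eq: "?S = {x. fst l \<bullet> x = - snd l}" by (auto simp: line_fun_def)
  have "aff_dim ?S < 2"
  proof (cases "fst l = 0")
    case True
    then have "?S = {}" using l by (cases l) (auto simp: line_fun_def valid_oline_def)
    then show ?thesis by simp
  next
    case False
    then show ?thesis unfolding eq by (simp add: aff_dim_hyperplane)
  qed
  moreover have S: "?S \<in> sets M"
    unfolding eq by (intro mass_distribution_borel_sets[OF M] borel_closed closed_hyperplane)
  ultimately have "?S \<in> null_sets M"
    using M by (auto simp: mass_distribution_def null_sets_def)
  then show ?thesis by (rule AE_I') auto
qed


section \<open>Clamped integrals over conics\<close>

text \<open>The masses may charge a conic that is not degenerate, so the measure of the positive side of a
  conic need not depend continuously on the conic. Integrating \<open>clamp1 (N * conic_poly q x)\<close>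
  instead restores continuity; its limit for \<open>N \<rightarrow> \<infinity>\<close> is only taken along degenerate conics,
  whose zero sets are covered by lines.\<close>

definition clamp1 :: "real \<Rightarrow> real" where
  "clamp1 t = max (-1) (min 1 t)"

lemma clamp1_minus: "clamp1 (- t) = - clamp1 t"
  by (auto simp: clamp1_def)

lemma abs_clamp1_le: "\<bar>clamp1 t\<bar> \<le> 1"
  by (auto simp: clamp1_def)

lemma tendsto_clamp1 [tendsto_intros]:
  "(f \<longlongrightarrow> l) F \<Longrightarrow> ((\<lambda>x. clamp1 (f x)) \<longlongrightarrow> clamp1 l) F"
  unfolding clamp1_def by (intro tendsto_intros)

lemma clamp1_measurable [measurable]: "clamp1 \<in> borel_measurable borel"
  unfolding clamp1_def by measurable

text \<open>The product diverges with the sign of \<open>l\<close>, so \<open>clamp1\<close> is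
  eventually saturated.\<close>

lemma clamp1_scaled_tendsto_sgn:
  assumes "u \<longlonglongrightarrow> l" "l \<noteq> 0" "filterlim N at_top sequentially"
  shows "(\<lambda>n. clamp1 (N n * u n)) \<longlonglongrightarrow> sgn l"
proof (cases "l > 0")
  case True
  have "filterlim (\<lambda>n. u n * N n) at_top sequentially"
    using filterlim_tendsto_pos_mult_at_top[OF assms(1) True assms(3)] .
  then have "eventually (\<lambda>n. u n * N n \<ge> 1) sequentially"
    by (simp add: filterlim_at_top)
  then have "eventually (\<lambda>n. clamp1 (N n * u n) = sgn l) sequentially"
    by eventually_elim (use True in \<open>simp add: clamp1_def mult.commute\<close>)
  then show ?thesis by (rule tendsto_eventually)
next
  case False
  then have "- l > 0" using assms(2) by simp
  have "filterlim (\<lambda>n. (- u n) * N n) at_top sequentially"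
    using filterlim_tendsto_pos_mult_at_top[OF tendsto_minus[OF assms(1)] \<open>- l > 0\<close> assms(3)] .
  then have "eventually (\<lambda>n. (- u n) * N n \<ge> 1) sequentially"
    unfolding filterlim_at_top by blast
  then have "eventually (\<lambda>n. clamp1 (N n * u n) = sgn l) sequentially"
    by eventually_elim (use \<open>- l > 0\<close> in \<open>simp add: clamp1_def mult.commute\<close>)
  then show ?thesis by (rule tendsto_eventually)
qed

lemma conic_poly_measurable [measurable]: "conic_poly q \<in> borel_measurable borel"
  unfolding conic_poly_def by (intro borel_measurable_continuous_onI continuous_intros)

lemma continuous_on_coordinate [continuous_intros]: "continuous_on S (\<lambda>x::nat \<Rightarrow> real. x i)"
  by (rule continuous_on_subset[OF continuous_on_product_coordinates subset_UNIV])

lemma tendsto_conic_poly: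
  assumes "X \<longlonglongrightarrow> q"
  shows "(\<lambda>n. conic_poly (X n) x) \<longlonglongrightarrow> conic_poly q x"
proof -
  have "(\<lambda>n. X n i) \<longlonglongrightarrow> q i" for i
    using continuous_on_tendsto_compose[OF continuous_on_coordinate[of UNIV] assms] by simp
  then show ?thesis unfolding conic_poly_def by (intro tendsto_intros)
qed

lemma conic_poly_minus: "conic_poly (\<lambda>j. - q j) x = - conic_poly q x"
  by (simp add: conic_poly_def)

lemma conic_det_minus: "conic_det (\<lambda>j. - q j) = - conic_det q"
  by (simp add: conic_det_def algebra_simps)

lemma continuous_on_conic_det: "continuous_on S conic_det"
  unfolding conic_det_def by (intro continuous_intros)

text \<open>Dominated convergence along sequences, with the bound 1, which is integrable because the
  mass is finite.\<close>

lemma continuous_on_integral_clamp1_conic: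
  assumes "mass_distribution M"
  shows "continuous_on S (\<lambda>q. \<integral>x. clamp1 (N * conic_poly q x) \<partial>M)"
proof -
  interpret finite_measure M using assms by (rule mass_distribution_finite)
  have meas: "(\<lambda>x. clamp1 (N * conic_poly q x)) \<in> borel_measurable M" for q
    by (rule mass_distribution_borel_measurable[OF assms]) measurable
  show ?thesis
    unfolding continuous_on_sequentially comp_def
  proof (intro allI ballI impI)
    fix X q assume "(\<forall>n. X n \<in> S) \<and> X \<longlonglongrightarrow> q"
    then have "X \<longlonglongrightarrow> q" by simp
    show "(\<lambda>n. \<integral>x. clamp1 (N * conic_poly (X n) x) \<partial>M) \<longlonglongrightarrow> (\<integral>x. clamp1 (N * conic_poly q x) \<partial>M)"
    proof (rule integral_dominated_convergence[where w = "\<lambda>_. 1"])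
      show "AE x in M. (\<lambda>n. clamp1 (N * conic_poly (X n) x)) \<longlonglongrightarrow> clamp1 (N * conic_poly q x)"
        by (intro AE_I2 tendsto_intros tendsto_conic_poly \<open>X \<longlonglongrightarrow> q\<close>)
    qed (auto simp: meas abs_clamp1_le)
  qed
qed

text \<open>Scale and conic vary together. Off the zero set of the limit conic the integrands
  converge to its sign, and dominated convergence applies.\<close>

lemma integral_sgn_conic_eq_0:
  assumes M: "mass_distribution M" and X: "X \<longlonglongrightarrow> q" and N: "filterlim N at_top sequentially"
    and zero: "\<And>n. (\<integral>x. clamp1 (N n * conic_poly (X n) x) \<partial>M) = 0"
    and null: "AE x in M. conic_poly q x \<noteq> 0"
  shows "(\<integral>x. sgn (conic_poly q x) \<partial>M) = 0"
proof -
  interpret finite_measure M using M by (rule mass_distribution_finite)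
  have "(\<lambda>n. \<integral>x. clamp1 (N n * conic_poly (X n) x) \<partial>M) \<longlonglongrightarrow> (\<integral>x. sgn (conic_poly q x) \<partial>M)"
  proof (rule integral_dominated_convergence[where w = "\<lambda>_. 1"])
    show "(\<lambda>x. sgn (conic_poly q x)) \<in> borel_measurable M"
      by (rule mass_distribution_borel_measurable[OF M]) measurable
    show "(\<lambda>x. clamp1 (N n * conic_poly (X n) x)) \<in> borel_measurable M" for n
      by (rule mass_distribution_borel_measurable[OF M]) measurable
    show "AE x in M. (\<lambda>n. clamp1 (N n * conic_poly (X n) x)) \<longlonglongrightarrow> sgn (conic_poly q x)"
      using null by eventually_elim (rule clamp1_scaled_tendsto_sgn[OF tendsto_conic_poly[OF X] _ N])
  qed (auto simp: abs_clamp1_le)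
  then show ?thesis
    unfolding zero by (simp add: LIMSEQ_const_iff)
qed

section \<open>Compactness of the sphere and the limit conic\<close>

lemma topspace_nsphere: "topspace (nsphere n) = {x. (\<Sum>i\<le>n. (x i)\<^sup>2) = 1 \<and> (\<forall>i>n. x i = 0)}"
  by (simp add: nsphere)

lemma nsphere_eq_top_of_set: "nsphere n = top_of_set (topspace (nsphere n))"
  unfolding topspace_nsphere by (simp add: nsphere euclidean_product_topology)

text \<open>The sphere is a closed subset of a countable power of the interval from -1 to 1, which
  is compact by Tychonoff.\<close>

lemma compact_nsphere: "compact (topspace (nsphere n))"
proof -
  have "compactin (powertop_real UNIV) (PiE UNIV (\<lambda>_. {-1..1::real}))"
    by (simp add: compactin_PiE)
  then have c: "compact (PiE UNIV (\<lambda>_::nat. {-1..1::real}))"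
    by (simp add: euclidean_product_topology)
  have "closed {x::nat \<Rightarrow> real. (\<Sum>i\<le>n. (x i)\<^sup>2) = 1}"
    by (intro closed_Collect_eq continuous_intros)
  moreover have "closed {x::nat \<Rightarrow> real. \<forall>i>n. x i = 0}"
    by (intro closed_Collect_all closed_Collect_imp closed_Collect_eq open_Collect_const
        continuous_intros)
  ultimately have "closed (topspace (nsphere n))"
    unfolding topspace_nsphere by (simp add: Collect_conj_eq closed_Int)
  moreover have "topspace (nsphere n) \<subseteq> PiE UNIV (\<lambda>_. {-1..1})"
  proof
    fix x assume x: "x \<in> topspace (nsphere n)"
    have "\<bar>x i\<bar> \<le> 1" for i
    proof (cases "i \<le> n")
      case True
      then have "(x i)\<^sup>2 \<le> (\<Sum>i\<le>n. (x i)\<^sup>2)" by (intro member_le_sum) auto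
      then show ?thesis using x by (simp add: topspace_nsphere abs_square_le_1)
    next
      case False
      then show ?thesis using x by (simp add: topspace_nsphere)
    qed
    then show "x \<in> PiE UNIV (\<lambda>_. {-1..1})" by (auto simp: abs_le_iff minus_le_iff)
  qed
  ultimately show ?thesis
    using c by (metis compact_Int_closed inf.absorb_iff2)
qed

lemma exists_approx_bisecting_conic:
  assumes len: "length Ms = 4" and Ms: "\<And>M. M \<in> set Ms \<Longrightarrow> mass_distribution M"
  shows "\<exists>q \<in> topspace (nsphere 5). conic_det q = 0 \<and> (\<forall>M\<in>set Ms. (\<integral>x. clamp1 (N * conic_poly q x) \<partial>M) = 0)"
proof -
  \<comment> \<open>Index 4 is the determinant, indices 0 to 3 are the four masses: five odd
    functions on the 5-sphere.\<close>
  define f where "f i q = (if i = 4 then conic_det q else \<integral>x. clamp1 (N * conic_poly q x) \<partial>(Ms ! i))" for i q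
  have "\<exists>q \<in> topspace (nsphere 5). \<forall>i<5. f i q = 0"
  proof (rule Borsuk_Ulam_nsphere)
    fix i :: nat assume "i < 5"
    show "continuous_map (nsphere 5) euclideanreal (f i)"
    proof (cases "i = 4")
      case True
      then show ?thesis
        by (subst nsphere_eq_top_of_set) (simp add: f_def[abs_def] continuous_on_conic_det)
    next
      case False
      then have "mass_distribution (Ms ! i)" using \<open>i < 5\<close> len by (intro Ms nth_mem) simp
      with False show ?thesis
        by (subst nsphere_eq_top_of_set) (simp add: f_def[abs_def] continuous_on_integral_clamp1_conic)
    qed
    show "f i (\<lambda>j. - q j) = - f i q" for q
      by (simp add: f_def conic_poly_minus conic_det_minus clamp1_minus)
  qed
  then obtain q where q: "q \<in> topspace (nsphere 5)" and z: "\<And>i. i < 5 \<Longrightarrow> f i q = 0" by blast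
  have "conic_det q = 0" using z[of 4] by (simp add: f_def)
  moreover have "(\<integral>x. clamp1 (N * conic_poly q x) \<partial>M) = 0" if M: "M \<in> set Ms" for M
  proof -
    obtain i where "i < length Ms" "M = Ms ! i" using M by (auto simp: in_set_conv_nth)
    then show ?thesis using z[of i] len by (simp add: f_def split: if_splits)
  qed
  ultimately show ?thesis using q by blast
qed

text \<open>By compactness the solutions for the scales \<open>n\<close> accumulate at a conic that
  is again degenerate and nonzero. In the limit the clamp becomes the sign, since the zero set of
  the limit conic is null in both alternatives.\<close>

lemma exists_bisecting_degenerate_conic:
  assumes len: "length Ms = 4" and Ms: "\<And>M. M \<in> set Ms \<Longrightarrow> mass_distribution M"
  shows "\<exists>l1 l2. valid_oline l1 \<and> valid_oline l2 \<and>
           (\<forall>M\<in>set Ms. (\<integral>x. sgn (line_fun l1 x * line_fun l2 x) \<partial>M) = 0)"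
proof -
  have "\<forall>n. \<exists>q \<in> topspace (nsphere 5). conic_det q = 0 \<and>
      (\<forall>M\<in>set Ms. (\<integral>x. clamp1 (real n * conic_poly q x) \<partial>M) = 0)"
    using exists_approx_bisecting_conic[OF assms] by blast
  then obtain X where X: "\<And>n. X n \<in> topspace (nsphere 5)" "\<And>n. conic_det (X n) = 0"
    and int: "\<And>n M. M \<in> set Ms \<Longrightarrow> (\<integral>x. clamp1 (real n * conic_poly (X n) x) \<partial>M) = 0"
    by metis
  obtain q r where q: "q \<in> topspace (nsphere 5)" and r: "strict_mono (r :: nat \<Rightarrow> nat)"
    and lim: "(X \<circ> r) \<longlonglongrightarrow> q"
    using compact_nsphere[of 5, unfolded compact_eq_seq_compact_metric seq_compact_def] X(1) by metis
  have "isCont conic_det q"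
    using continuous_on_conic_det[of UNIV] by (simp add: continuous_on_eq_continuous_at)
  then have "(\<lambda>n. conic_det ((X \<circ> r) n)) \<longlonglongrightarrow> conic_det q"
    using lim by (rule isCont_tendsto_compose)
  then have det: "conic_det q = 0" by (simp add: X(2) LIMSEQ_const_iff)
  have nz: "\<exists>i\<le>5. q i \<noteq> 0"
  proof (rule ccontr)
    assume "\<not> ?thesis"
    then have "(\<Sum>i\<le>5. (q i)\<^sup>2) = 0" by (intro sum.neutral) auto
    then show False using q by (simp add: topspace_nsphere)
  qed
  have N: "filterlim (\<lambda>n. real (r n)) at_top sequentially"
    by (rule filterlim_compose[OF filterlim_real_sequentially filterlim_subseq[OF r]])
  have zero: "(\<integral>x. sgn (conic_poly q x) \<partial>M) = 0" if "M \<in> set Ms" "AE x in M. conic_poly q x \<noteq> 0" for M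
    using integral_sgn_conic_eq_0[OF Ms[OF that(1)] lim N _ that(2)] int[OF that(1)] by simp
  from degenerate_conic_cases[OF det nz] show ?thesis
  proof (elim disjE exE conjE)
    fix l1 l2 assume l: "valid_oline l1" "valid_oline l2" "\<forall>x. conic_poly q x = line_fun l1 x * line_fun l2 x"
    have "(\<integral>x. sgn (line_fun l1 x * line_fun l2 x) \<partial>M) = 0" if "M \<in> set Ms" for M
    proof -
      have "AE x in M. conic_poly q x \<noteq> 0"
        using mass_distribution_line_null[OF Ms[OF that] l(1)] mass_distribution_line_null[OF Ms[OF that] l(2)]
        by eventually_elim (simp add: l(3))
      from zero[OF that this] show ?thesis by (simp add: l(3))
    qed
    then show ?thesis using l by blast
  next
    fix l s assume l: "valid_oline l" "\<forall>x. (line_fun l x)\<^sup>2 \<le> s * conic_poly q x"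
    \<comment> \<open>One measure leads to a contradiction: the sign of the conic is almost
      everywhere that of \<open>s\<close>, so its integral is plus or minus the total mass.\<close>
    obtain M where M: "M \<in> set Ms" using len by (cases Ms) auto
    interpret finite_measure M using Ms[OF M] by (rule mass_distribution_finite)
    have sgn: "AE x in M. conic_poly q x \<noteq> 0 \<and> sgn (conic_poly q x) = sgn s"
      using mass_distribution_line_null[OF Ms[OF M] l(1)]
    proof eventually_elim
      fix x assume "line_fun l x \<noteq> 0"
      then have "0 < (line_fun l x)\<^sup>2" by simp
      also have "\<dots> \<le> s * conic_poly q x" using l by simp
      finally show "conic_poly q x \<noteq> 0 \<and> sgn (conic_poly q x) = sgn s"
        by (auto simp: zero_less_mult_iff sgn_if)
    qed
    have "(\<integral>x. sgn (conic_poly q x) \<partial>M) = (\<integral>x. sgn s \<partial>M)"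
    proof (rule integral_cong_AE)
      show "(\<lambda>x. sgn (conic_poly q x)) \<in> borel_measurable M"
        by (rule mass_distribution_borel_measurable[OF Ms[OF M]]) measurable
      show "AE x in M. sgn (conic_poly q x) = sgn s" using sgn by eventually_elim simp
    qed simp
    moreover have "(\<integral>x. sgn (conic_poly q x) \<partial>M) = 0"
    proof (rule zero[OF M])
      show "AE x in M. conic_poly q x \<noteq> 0" using sgn by eventually_elim simp
    qed
    ultimately have "sgn s * measure M (space M) = 0" by auto
    moreover have "measure M (space M) > 0"
      using Ms[OF M] by (simp add: mass_distribution_def measure_def enn2real_positive_iff)
    \<comment> \<open>For \<open>s = 0\<close> the function of \<open>l\<close> would vanish
      everywhere, but its zero set is null.\<close>
    moreover have "s \<noteq> 0"
    proof
      assume "s = 0"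
      have "AE x in M. False"
        using mass_distribution_line_null[OF Ms[OF M] l(1)]
        by (rule eventually_mono) (use l(2) \<open>s = 0\<close> in simp)
      then have "emeasure M (space M) = 0" by (simp add: AE_iff_null null_sets_def)
      then show False using Ms[OF M] by (simp add: mass_distribution_def)
    qed
    ultimately have False by (auto simp: sgn_zero_iff)
    then show ?thesis ..
  qed
qed

section \<open>From sign integrals to bisection\<close>

text \<open>Off the two null lines, the number of positive sides is even exactly where the product
  of the line functions is positive, so the integral is the mass of \<open>R_plus\<close> minus that
  of \<open>R_minus\<close>.\<close>

lemma emeasure_R_plus_eq_R_minus:
  assumes M: "mass_distribution M" and l: "valid_oline l1" "valid_oline l2"
    and int: "(\<integral>x. sgn (line_fun l1 x * line_fun l2 x) \<partial>M) = 0"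
  shows "emeasure M (R_plus [l1, l2]) = emeasure M (R_minus [l1, l2])"
proof -
  interpret finite_measure M using M by (rule mass_distribution_finite)
  let ?P = "R_plus [l1, l2]" and ?N = "R_minus [l1, l2]"
  have P: "?P = {x. line_fun l1 x \<ge> 0 \<longleftrightarrow> line_fun l2 x \<ge> 0}" and N: "?N = - ?P"
    by (auto simp: R_plus_def R_minus_def lam_def pos_side_def line_fun_def)
  have [measurable]: "line_fun l \<in> borel_measurable borel" for l
    unfolding line_fun_def by (intro borel_measurable_continuous_onI continuous_intros)
  have "?P \<in> sets borel" unfolding P by measurable
  then have sets: "?P \<in> sets M" "?N \<in> sets M"
    unfolding N by (auto intro!: mass_distribution_borel_sets[OF M])
  have "(\<integral>x. sgn (line_fun l1 x * line_fun l2 x) \<partial>M) = (\<integral>x. indicator ?P x - indicator ?N x \<partial>M)"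
  proof (rule integral_cong_AE)
    show "(\<lambda>x. sgn (line_fun l1 x * line_fun l2 x)) \<in> borel_measurable M"
      by (rule mass_distribution_borel_measurable[OF M]) measurable
    show "(\<lambda>x. indicator ?P x - indicator ?N x :: real) \<in> borel_measurable M"
      using sets by measurable
    show "AE x in M. sgn (line_fun l1 x * line_fun l2 x) = indicator ?P x - indicator ?N x"
      using mass_distribution_line_null[OF M l(1)] mass_distribution_line_null[OF M l(2)]
      by eventually_elim (auto simp: N P indicator_def sgn_if zero_less_mult_iff)
  qed
  also have "\<dots> = measure M ?P - measure M ?N"
    using sets by (simp add: M emeasure_eq_measure)
  finally show ?thesis using int by (simp add: emeasure_eq_measure)
qed

theorem theorem2:
  fixes \<mu>1 \<mu>2 \<mu>3 \<mu>4 :: "(real^2) measure"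
  assumes "mass_distribution \<mu>1" "mass_distribution \<mu>2"
          "mass_distribution \<mu>3" "mass_distribution \<mu>4"
  shows "\<exists>l1 l2. valid_oline l1 \<and> valid_oline l2 \<and>
           sim_bisects [l1, l2] [\<mu>1, \<mu>2, \<mu>3, \<mu>4]"
proof -
  let ?Ms = "[\<mu>1, \<mu>2, \<mu>3, \<mu>4]"
  have Ms: "mass_distribution M" if "M \<in> set ?Ms" for M
    using that assms by auto
  obtain l1 l2 where l: "valid_oline l1" "valid_oline l2"
    and int: "\<And>M. M \<in> set ?Ms \<Longrightarrow> (\<integral>x. sgn (line_fun l1 x * line_fun l2 x) \<partial>M) = 0"
    using exists_bisecting_degenerate_conic[of ?Ms] Ms by auto
  have "sim_bisects [l1, l2] ?Ms"
    unfolding sim_bisects_def using emeasure_R_plus_eq_R_minus[OF Ms l int] by blast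
  then show ?thesis using l by blast
qed

end
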